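(* Let $C$ be a nonempty closed convex subset of a real Hilbert space $H$ and let $\mathcal{F}:H\to H$. Assume that (A1)–(A7) (listed in the context) hold and that the set $VI(C,\mathcal{F})$ is finite. Then the sequence $\{x_n\}$ generated by Algorithm MDISEM (described in the context) converges weakly to an element of $VI(C,\mathcal{F})$.
   Context: Notation. $VI(C,\mathcal{F})=\{x\in C:\langle \mathcal{F}x,y-x\rangle\ge 0\ \text{for all } y\in C\}$ and $S_{\mathcal{F}}=\{x\in C:\langle \mathcal{F}y,y-x\rangle\ge 0\ \text{for all } y\in C\}$. $P_D$ denotes the metric projection of $H$ onto a nonempty closed convex set $D$; $\rightharpoonup$ denotes weak convergence. $\mathcal{F}$ is $L$-Lipschitz continuous on $H$ if $\|\mathcal{F}x-\mathcal{F}y\|\le L\|x-y\|$ for all $x,y\in H$, where $L>0$. Assumptions. (A1) $\mathcal{F}$ is $L$-Lipschitz continuous on $H$ and sequentially weakly continuous on $C$. (A2) $S_{\mathcal{F}}\neq\emptyset$. (A3) Whenever $\{z_n\}\subset H$ satisfies $z_n\rightharpoonup v$ and $\limsup_{n\to\infty}\langle \mathcal{F}z_n,z_n\rangle\le\langle \mathcal{F}v,v\rangle$, then $\lim_{n\to\infty}\langle \mathcal{F}z_n,z_n\rangle=\langle \mathcal{F}v,v\rangle$. (A4) $0\le\nu_n\le\nu_{n+1}\le 1$ for all $n\ge1$. (A5) $0\le\xi_n\le\xi_{n+1}\le\xi<\min\left\{\frac{\bar\theta-\sqrt{2\bar\theta}}{\bar\theta},\nu_1\right\}$ for all $n\ge1$,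 where $\bar\theta\in(2,+\infty)$. (A6) $0<\alpha\le\alpha_n\le\alpha_{n+1}<\frac{1}{1+\bar\theta}$ for all $n\ge1$, with the same $\bar\theta\in(2,+\infty)$. (A7) $\{\delta_n\}\subset[1,+\infty)$ with $\lim_{n\to\infty}\delta_n=1$; $\{\chi_n\}\subset[1,+\infty)$ with $\sum_{n=1}^\infty(\chi_n-1)<+\infty$; $\{\zeta_n\}\subset[0,+\infty)$ with $\sum_{n=0}^\infty\zeta_n<+\infty$. Algorithm MDISEM. Choose $\mu\in(0,1)$, $\lambda_1>0$, $\sigma\in(0,\frac{2}{\mu})$, $\beta\in(\frac{\sigma}{2},\frac{1}{\mu})$ and $x_0,x_1\in H$. For $n=1,2,\dots$: Step 1. $w_n=x_n+\nu_n(x_n-x_{n-1})$, $y_n=P_C(w_n-\beta\lambda_n\mathcal{F}w_n)$, and $\lambda_{n+1}=\min\left\{\frac{\mu\delta_n\|w_n-y_n\|}{\|\mathcal{F}w_n-\mathcal{F}y_n\|},\chi_n\lambda_n+\zeta_n\right\}$ if $\mathcal{F}w_n\ne\mathcal{F}y_n$, and $\lambda_{n+1}=\chi_n\lambda_n+\zeta_n$ otherwise. If $w_n=y_n$ or $\mathcal{F}y_n=0$, stop. Otherwise: Step 2. $u_n=P_{T_n}(w_n-\sigma\lambda_nd_n\mathcal{F}y_n)$, where $T_n=\{x\in H:\langle w_n-\beta\lambda_n\mathcal{F}w_n-y_n,x-y_n\rangle\le0\}$, $\eta_n=w_n-y_n-\beta\lambda_n(\mathcal{F}w_n-\mathcal{F}y_n)$,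 $d_n=\frac{\langle w_n-y_n,\eta_n\rangle}{\|\eta_n\|^2}$. Step 3. $v_n=x_n+\xi_n(x_n-x_{n-1})$, $x_{n+1}=(1-\alpha_n)v_n+\alpha_nu_n$; replace $n$ by $n+1$ and return to Step 1. It is understood that the algorithm does not stop and generates an infinite sequence with all quantities well defined (in particular $\eta_n\ne0$ for every $n$). *)

theory Defs
  imports "HOL-Analysis.Analysis"
begin

text \<open>A real Hilbert space is a type of sort \<open>{real_inner, complete_space}\<close>; its dimension
  is arbitrary.\<close>

definition VI :: "'a::real_inner set \<Rightarrow> ('a \<Rightarrow> 'a) \<Rightarrow> 'a set" where
  "VI C F = {x \<in> C. \<forall>y\<in>C. F x \<bullet> (y - x) \<ge> 0}"

text \<open>The argument of \<open>F\<close> is the test point here, in contrast to \<open>VI\<close>.\<close>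

definition dual_VI :: "'a::real_inner set \<Rightarrow> ('a \<Rightarrow> 'a) \<Rightarrow> 'a set" where
  "dual_VI C F = {x \<in> C. \<forall>y\<in>C. F y \<bullet> (y - x) \<ge> 0}"

text \<open>The same formula as \<^const>\<open>closest_point\<close>, whose sort constraint \<open>heine_borel\<close> would
  force finite dimension. The nearest point exists and is unique if \<open>D\<close> is nonempty, closed and
  convex and the space is complete.\<close>

definition metric_proj :: "'a::real_inner set \<Rightarrow> 'a \<Rightarrow> 'a" where
  "metric_proj D a = (SOME p. p \<in> D \<and> (\<forall>q\<in>D. dist a p \<le> dist a q))"

definition weakly_converges :: "(nat \<Rightarrow> 'a::real_normed_vector) \<Rightarrow> 'a \<Rightarrow> bool" where
  "weakly_converges z v \<longleftrightarrow>
     (\<forall>f :: 'a \<Rightarrow> real. bounded_linear f \<longrightarrow> (\<lambda>n. f (z n)) \<longlonglongrightarrow> f v)"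

definition seq_weakly_continuous_on ::
    "'a::real_normed_vector set \<Rightarrow> ('a \<Rightarrow> 'a) \<Rightarrow> bool" where
  "seq_weakly_continuous_on C F \<longleftrightarrow>
     (\<forall>z v. (\<forall>n. z n \<in> C) \<longrightarrow> v \<in> C \<longrightarrow> weakly_converges z v
        \<longrightarrow> weakly_converges (\<lambda>n. F (z n)) (F v))"

end

theory Submission
  imports Defs "HOL-Library.Diagonal_Subsequence"
begin

text \<open>
  The inequality that makes the iterates approach solutions holds only relative to a point \<open>p\<close> of
  \<^const>\<open>dual_VI\<close>, while weak limits are only known to lie in \<^const>\<open>VI\<close>. So
  Opial's argument, which needs control of the distances to every weak cluster point, does not
  apply. What replaces it is elementary: if \<open>x\<close> is bounded, the steps
  \<open>x (n + 1) - x n\<close> tend to 0 and all weak cluster points lie in a finite set, then \<open>x\<close> converges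
  weakly. Indeed, for a fixed vector \<open>e\<close> the real sequence \<open>x n \<bullet> e\<close> has vanishing steps, so it could
  oscillate between two cluster values only by having all values in between as cluster values, while
  weak compactness leaves only the finitely many values at the weak cluster points
  (\<open>weakly_convergent_if_finite_cluster_points\<close>). The point \<open>p\<close> serves to prove boundedness and
  vanishing of the steps, and need not be the limit.

  The step sizes are bounded below by the Lipschitz condition, and up to a summable error they
  decrease; hence consecutive ratios tend to 1 (\<open>ratio_tendsto_1_of_summable_growth\<close>), and
  since \<open>\<beta> * \<mu> < 1\<close> the vector \<open>\<eta> n\<close> is eventually a relative perturbation of \<open>w n - y n\<close> by a factor
  below 1. From then on the projection onto the half-space brings \<open>u n\<close> closer to \<open>p\<close> than \<open>w n\<close>, with a
  gain of at least a fixed multiple of the square of \<open>norm (w n - y n)\<close> (\<open>extragradient_step\<close>).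

  Averaging \<open>u n\<close> with the second inertial point turns this into a second-order recursion for the
  squared distances to \<open>p\<close> (\<open>inertial_averaging_step\<close>). The restrictions on the weights give it a
  decreasing Lyapunov function (\<open>inertial_lyapunov\<close>), which yields boundedness of \<open>x\<close>,
  \<open>x (n + 1) - x n \<longlonglongrightarrow> 0\<close> and \<open>w n - y n \<longlonglongrightarrow> 0\<close>.

  Then \<open>x\<close>, \<open>w\<close> and \<open>y\<close> have the same weak cluster points, and the inequality that
  characterises \<open>y n\<close> as a projection passes to the weak limit (\<open>weak_limit_mem_VI\<close>). The compactness
  used on the way, that bounded sequences have weakly convergent subsequences, follows from nearest
  points in closed convex sets and the Riesz representation.
\<close>

section \<open>Nearest points in Hilbert spaces\<close>

lemma nearest_point_exists:
  fixes D :: "'a::{real_inner, complete_space} set"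
  assumes "D \<noteq> {}" "closed D" "convex D"
  shows "\<exists>p\<in>D. \<forall>q\<in>D. dist a p \<le> dist a q"
proof -
  define r where "r = infdist a D"
  have low: "r \<le> dist a q" if "q \<in> D" for q
    using that by (simp add: r_def infdist_le)
  have r0: "r \<ge> 0"
    by (simp add: r_def infdist_nonneg)
  have "\<exists>q\<in>D. dist a q < r + inverse (real (Suc n))" for n
  proof -
    have "(INF q\<in>D. dist a q) < r + inverse (real (Suc n))"
      using assms(1) by (simp add: r_def infdist_notempty)
    then show ?thesis
      using assms(1) by (subst (asm) cINF_less_iff) (auto intro: bdd_belowI2[of _ 0])
  qed
  then obtain q where q: "\<And>n. q n \<in> D" "\<And>n. dist a (q n) < r + inverse (real (Suc n))"
    by metis
  have lim: "(\<lambda>n. dist a (q n)) \<longlonglongrightarrow> r"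
  proof (rule tendsto_sandwich[OF _ _ tendsto_const])
    show "(\<lambda>n. r + inverse (real (Suc n))) \<longlonglongrightarrow> r"
      using tendsto_add[OF tendsto_const LIMSEQ_inverse_real_of_nat, of r] by simp
  qed (use low q in \<open>auto intro!: always_eventually less_imp_le\<close>)
  then have lim2: "(\<lambda>n. (dist a (q n))\<^sup>2) \<longlonglongrightarrow> r\<^sup>2"
    by (intro tendsto_intros)
  \<comment> \<open>The midpoint of two members is at distance at least \<open>r\<close>, so the parallelogram law bounds
      their distance.\<close>
  have para: "(dist (q m) (q n))\<^sup>2 \<le> 2 * ((dist a (q m))\<^sup>2 - r\<^sup>2) + 2 * ((dist a (q n))\<^sup>2 - r\<^sup>2)"
    for m n
  proof -
    let ?z = "(1/2) *\<^sub>R q m + (1/2) *\<^sub>R q n"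
    have "?z \<in> D"
      using convexD[OF assms(3), of "q m" "q n" "1/2" "1/2"] q by simp
    then have "r\<^sup>2 \<le> (dist a ?z)\<^sup>2"
      using low r0 by (intro power_mono) auto
    moreover have "(dist (q m) (q n))\<^sup>2
        = 2 * (dist a (q m))\<^sup>2 + 2 * (dist a (q n))\<^sup>2 - 4 * (dist a ?z)\<^sup>2"
      by (simp add: dist_norm power2_norm_eq_inner inner_simps inner_commute algebra_simps)
    ultimately show ?thesis by simp
  qed
  have "Cauchy q"
  proof (rule metric_CauchyI)
    fix e :: real assume "e > 0"
    then have "\<forall>\<^sub>F n in sequentially. (dist a (q n))\<^sup>2 < r\<^sup>2 + e\<^sup>2 / 4"
      using order_tendstoD(2)[OF lim2] by simp
    then obtain M where M: "\<And>n. n \<ge> M \<Longrightarrow> (dist a (q n))\<^sup>2 < r\<^sup>2 + e\<^sup>2 / 4"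
      by (auto simp: eventually_sequentially)
    have "dist (q m) (q n) < e" if "m \<ge> M" "n \<ge> M" for m n
    proof -
      have "(dist (q m) (q n))\<^sup>2 < e\<^sup>2"
        using para[of m n] M[OF that(1)] M[OF that(2)] by simp
      then show ?thesis
        using \<open>e > 0\<close> power2_less_imp_less by fastforce
    qed
    then show "\<exists>M. \<forall>m\<ge>M. \<forall>n\<ge>M. dist (q m) (q n) < e" by blast
  qed
  then obtain p where p: "q \<longlonglongrightarrow> p"
    using Cauchy_convergent convergent_def by blast
  have "p \<in> D"
    using closed_sequentially[OF assms(2)] q(1) p by blast
  moreover have "dist a p = r"
    using LIMSEQ_unique[OF tendsto_dist[OF tendsto_const p] lim] .
  ultimately show ?thesis using low by auto
qed

lemma
  fixes D :: "'a::{real_inner, complete_space} set"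
  assumes "D \<noteq> {}" "closed D" "convex D"
  shows metric_proj_mem: "metric_proj D a \<in> D"
    and metric_proj_obtuse: "q \<in> D \<Longrightarrow> (a - metric_proj D a) \<bullet> (q - metric_proj D a) \<le> 0"
proof -
  have P: "metric_proj D a \<in> D \<and> (\<forall>q\<in>D. dist a (metric_proj D a) \<le> dist a q)"
    unfolding metric_proj_def
    by (rule someI_ex) (use nearest_point_exists[OF assms] in blast)
  then show "metric_proj D a \<in> D" by blast
  show "q \<in> D \<Longrightarrow> (a - metric_proj D a) \<bullet> (q - metric_proj D a) \<le> 0"
    by (rule any_closest_point_dot[OF assms(3,2)]) (use P in auto)
qed

text \<open>On a subspace the obtuse-angle inequality applies to both directions \<open>e\<close> and \<open>- e\<close>.\<close>

lemma metric_proj_orthogonal: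
  fixes S :: "'a::{real_inner, complete_space} set"
  assumes "subspace S" "closed S" "e \<in> S"
  shows "(a - metric_proj S a) \<bullet> e = 0"
proof -
  have S: "S \<noteq> {}" "convex S"
    using assms subspace_imp_convex by auto
  note pr = metric_proj_mem[OF S(1) assms(2) S(2), of a]
    metric_proj_obtuse[OF S(1) assms(2) S(2), of _ a]
  have "(a - metric_proj S a) \<bullet> ((metric_proj S a + e) - metric_proj S a) \<le> 0"
    by (intro pr subspace_add assms)
  moreover have "(a - metric_proj S a) \<bullet> ((metric_proj S a - e) - metric_proj S a) \<le> 0"
    by (intro pr subspace_diff assms)
  ultimately show ?thesis by simp
qed

text \<open>Subtracting from a vector outside the kernel of \<open>f\<close> its projection onto the kernel leaves a
  vector that spans the orthogonal complement of the kernel; a multiple of it represents \<open>f\<close>.\<close>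

lemma riesz_representation:
  fixes f :: "'a::{real_inner, complete_space} \<Rightarrow> real"
  assumes "bounded_linear f"
  shows "\<exists>p. \<forall>z. f z = z \<bullet> p"
proof (cases "\<forall>z. f z = 0")
  case True
  then show ?thesis by (intro exI[of _ 0]) simp
next
  case False
  then obtain a where a: "f a \<noteq> 0" by blast
  interpret bounded_linear f by fact
  let ?K = "{z. f z = 0}"
  have sub: "subspace ?K"
    by (auto simp: subspace_def add scaleR zero)
  have cl: "closed ?K"
    by (intro closed_Collect_eq continuous_intros continuous_on)
  define h where "h = a - metric_proj ?K a"
  have orth: "h \<bullet> e = 0" if "f e = 0" for e
    using metric_proj_orthogonal[OF sub cl, of e a] that by (simp add: h_def)
  have "metric_proj ?K a \<in> ?K"
    using sub cl subspace_imp_convex subspace_0 by (intro metric_proj_mem) auto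
  then have fh: "f h = f a"
    by (simp add: h_def diff)
  then have h0: "h \<noteq> 0"
    using a zero by auto
  have "f z = z \<bullet> ((f h / (h \<bullet> h)) *\<^sub>R h)" for z
  proof -
    have "h \<bullet> (z - (f z / f h) *\<^sub>R h) = 0"
      by (rule orth) (use a fh in \<open>simp add: diff scaleR\<close>)
    then have "h \<bullet> z = (f z / f h) * (h \<bullet> h)"
      by (simp add: inner_diff_right)
    then show ?thesis
      using h0 a fh by (simp add: inner_commute field_simps)
  qed
  then show ?thesis by blast
qed

section \<open>Weak convergence\<close>

lemma weakly_converges_iff_inner:
  fixes z :: "nat \<Rightarrow> 'a::{real_inner, complete_space}"
  shows "weakly_converges z p \<longleftrightarrow> (\<forall>e. (\<lambda>n. z n \<bullet> e) \<longlonglongrightarrow> p \<bullet> e)"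
proof
  assume "weakly_converges z p"
  then show "\<forall>e. (\<lambda>n. z n \<bullet> e) \<longlonglongrightarrow> p \<bullet> e"
    by (auto simp: weakly_converges_def intro: bounded_linear_inner_left)
next
  assume *: "\<forall>e. (\<lambda>n. z n \<bullet> e) \<longlonglongrightarrow> p \<bullet> e"
  show "weakly_converges z p"
    unfolding weakly_converges_def
  proof (intro allI impI)
    fix f :: "'a \<Rightarrow> real" assume "bounded_linear f"
    then obtain e where "\<And>z. f z = z \<bullet> e"
      using riesz_representation by blast
    then show "(\<lambda>n. f (z n)) \<longlonglongrightarrow> f p" using * by simp
  qed
qed

lemma weakly_converges_perturb:
  assumes "weakly_converges z p" "(\<lambda>n. z n - z' n) \<longlonglongrightarrow> 0"
  shows "weakly_converges z' p"
  unfolding weakly_converges_def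
proof (intro allI impI)
  fix f :: "'a \<Rightarrow> real" assume f: "bounded_linear f"
  interpret f: bounded_linear f by fact
  have "(\<lambda>n. f (z n) - f (z n - z' n)) \<longlonglongrightarrow> f p - 0"
    using assms f f.tendsto_zero by (intro tendsto_diff) (auto simp: weakly_converges_def)
  then show "(\<lambda>n. f (z' n)) \<longlonglongrightarrow> f p"
    by (simp add: f.diff)
qed

text \<open>If the limit lay outside the set, the hyperplane normal to the segment from the limit to its
  projection would separate the limit from the sequence.\<close>

lemma closed_convex_weakly_sequentially_closed:
  fixes D :: "'a::{real_inner, complete_space} set"
  assumes "closed D" "convex D" "\<And>n. z n \<in> D" "weakly_converges z p"
  shows "p \<in> D"
proof -
  have ne: "D \<noteq> {}" using assms(3) by auto
  let ?q = "metric_proj D p"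
  have "(\<lambda>n. z n \<bullet> (p - ?q)) \<longlonglongrightarrow> p \<bullet> (p - ?q)"
    using assms(4) by (simp add: weakly_converges_iff_inner)
  moreover have "z n \<bullet> (p - ?q) \<le> ?q \<bullet> (p - ?q)" for n
    using metric_proj_obtuse[OF ne assms(1,2,3), of p n]
    by (simp add: inner_diff_right inner_diff_left inner_commute)
  ultimately have "p \<bullet> (p - ?q) \<le> ?q \<bullet> (p - ?q)"
    using LIMSEQ_le_const2 by blast
  then have "(p - ?q) \<bullet> (p - ?q) \<le> 0"
    by (simp add: inner_diff_left)
  then have "p = ?q"
    by (metis inner_gt_zero_iff not_le right_minus_eq)
  then show ?thesis
    using metric_proj_mem[OF ne assms(1,2)] by metis
qed

lemma convergent_uniform_approx:
  fixes X :: "nat \<Rightarrow> real"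
  assumes "\<And>e. e > 0 \<Longrightarrow> \<exists>Y. convergent Y \<and> (\<forall>n. \<bar>X n - Y n\<bar> \<le> e)"
  shows "convergent X"
proof -
  have "Cauchy X"
  proof (rule metric_CauchyI)
    fix e :: real assume "e > 0"
    then obtain Y where Y: "convergent Y" "\<And>n. \<bar>X n - Y n\<bar> \<le> e/4"
      using assms[of "e/4"] by auto
    obtain M where M: "\<And>m n. m \<ge> M \<Longrightarrow> n \<ge> M \<Longrightarrow> dist (Y m) (Y n) < e/4"
      using metric_CauchyD[OF convergent_Cauchy[OF Y(1)], of "e/4"] \<open>e > 0\<close> by auto
    have "dist (X m) (X n) < e" if "m \<ge> M" "n \<ge> M" for m n
      using M[OF that] Y(2)[of m] Y(2)[of n] \<open>e > 0\<close> unfolding dist_real_def by linarith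
    then show "\<exists>M. \<forall>m\<ge>M. \<forall>n\<ge>M. dist (X m) (X n) < e" by blast
  qed
  then show ?thesis by (simp add: Cauchy_convergent)
qed

text \<open>A diagonal argument gives a subsequence whose inner products with every \<open>z m\<close> converge.
  The vectors with this property form a closed subspace; it is the whole space, and the limits are a
  bounded linear functional, represented by the weak limit.\<close>

lemma bounded_imp_weakly_convergent_subseq:
  fixes z :: "nat \<Rightarrow> 'a::{real_inner, complete_space}"
  assumes bdd: "\<And>n. norm (z n) \<le> B"
  shows "\<exists>r p. strict_mono (r::nat\<Rightarrow>nat) \<and> weakly_converges (z \<circ> r) p"
proof -
  have B0: "0 \<le> B" using norm_ge_zero[of "z 0"] bdd[of 0] by linarith
  have inner_bdd: "\<bar>z n \<bullet> e\<bar> \<le> B * norm e" for n e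
    using Cauchy_Schwarz_ineq2[of "z n" e] mult_right_mono[OF bdd[of n] norm_ge_zero[of e]]
    by linarith
  interpret subseqs "\<lambda>m s. convergent (\<lambda>n. z (s n) \<bullet> z m)"
  proof (unfold_locales)
    fix m and s :: "nat \<Rightarrow> nat"
    have "bounded (range (\<lambda>n. z (s n) \<bullet> z m))"
      by (rule boundedI[of _ "B * norm (z m)"]) (use inner_bdd in auto)
    then obtain l r' where "strict_mono (r' :: nat \<Rightarrow> nat)"
        "((\<lambda>n. z (s n) \<bullet> z m) \<circ> r') \<longlonglongrightarrow> l"
      using bounded_imp_convergent_subsequence by metis
    then show "\<exists>r'. strict_mono r' \<and> convergent (\<lambda>n. z ((s \<circ> r') n) \<bullet> z m)"
      by (auto simp: o_def convergent_def)
  qed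
  let ?r = "diagseq"
  have diag: "convergent (\<lambda>n. z (?r n) \<bullet> z m)" for m
  proof -
    have "convergent (\<lambda>n. z ((?r \<circ> (+) (Suc m)) n) \<bullet> z m)"
      by (rule diagseq_holds)
        (auto simp: o_def dest: convergent_subseq_convergent[unfolded o_def])
    then show ?thesis
      using convergent_ignore_initial_segment[of "\<lambda>n. z (?r n) \<bullet> z m" "Suc m"]
      by (simp add: o_def add.commute)
  qed
  define E where "E = {e. convergent (\<lambda>n. z (?r n) \<bullet> e)}"
  have sub: "subspace E"
    by (auto simp: subspace_def E_def inner_add_right convergent_const
        intro: convergent_add convergent_mult)
  have "closed E"
    unfolding closed_sequential_limits
  proof (intro allI impI, elim conjE)
    fix g l assume g: "\<forall>n. g n \<in> E" and l: "g \<longlonglongrightarrow> l"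
    have "convergent (\<lambda>n. z (?r n) \<bullet> l)"
    proof (rule convergent_uniform_approx)
      fix e :: real assume "e > 0"
      then obtain k where k: "norm (g k - l) < e / (B + 1)"
        using l B0 LIMSEQ_D[OF l, of "e / (B + 1)"] by auto
      have "\<bar>z (?r n) \<bullet> l - z (?r n) \<bullet> g k\<bar> \<le> e" for n
      proof -
        have "\<bar>z (?r n) \<bullet> l - z (?r n) \<bullet> g k\<bar> \<le> B * norm (l - g k)"
          using inner_bdd[of "?r n" "l - g k"] by (simp add: inner_diff_right)
        also have "\<dots> \<le> (B + 1) * norm (l - g k)"
          by (simp add: mult_right_mono)
        also have "\<dots> \<le> e"
          using k B0 by (simp add: norm_minus_commute field_simps)
        finally show ?thesis .
      qed
      then show "\<exists>Y. convergent Y \<and> (\<forall>n. \<bar>z (?r n) \<bullet> l - Y n\<bar> \<le> e)"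
        using g by (auto simp: E_def)
    qed
    then show "l \<in> E" by (simp add: E_def)
  qed
  \<comment> \<open>The part of a vector orthogonal to \<open>E\<close> is orthogonal to every \<open>z n\<close>, so it also lies in \<open>E\<close>.\<close>
  have all: "e \<in> E" for e
  proof -
    let ?h = "e - metric_proj E e"
    have "?h \<bullet> z n = 0" for n
      by (rule metric_proj_orthogonal[OF sub \<open>closed E\<close>]) (simp add: E_def diag)
    then have "?h \<in> E"
      by (simp add: E_def inner_commute convergent_const)
    moreover have "metric_proj E e \<in> E"
      using sub \<open>closed E\<close> subspace_imp_convex subspace_0 by (intro metric_proj_mem) auto
    ultimately show ?thesis
      using subspace_add[OF sub, of ?h "metric_proj E e"] by simp
  qed
  define f where "f e = lim (\<lambda>n. z (?r n) \<bullet> e)" for e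
  have f: "(\<lambda>n. z (?r n) \<bullet> e) \<longlonglongrightarrow> f e" for e
    using all[of e] by (simp add: E_def f_def convergent_LIMSEQ_iff)
  have "bounded_linear f"
  proof (rule bounded_linear_intro[where K = B])
    show "f (a + b) = f a + f b" for a b
      using LIMSEQ_unique[OF f[of "a + b"]] tendsto_add[OF f[of a] f[of b]]
      by (simp add: inner_add_right)
    show "f (c *\<^sub>R a) = c *\<^sub>R f a" for c a
      using LIMSEQ_unique[OF f[of "c *\<^sub>R a"]] tendsto_mult_left[OF f[of a], of c]
      by simp
    show "norm (f a) \<le> norm a * B" for a
    proof -
      have "(\<lambda>n. \<bar>z (?r n) \<bullet> a\<bar>) \<longlonglongrightarrow> \<bar>f a\<bar>"
        by (intro tendsto_rabs f)
      then show ?thesis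
        using LIMSEQ_le_const2[of _ "\<bar>f a\<bar>" "B * norm a"] inner_bdd
        by (auto simp: mult.commute)
    qed
  qed
  then obtain p where "\<And>e. f e = e \<bullet> p"
    using riesz_representation by blast
  then have "weakly_converges (z \<circ> ?r) p"
    using f by (simp add: weakly_converges_iff_inner o_def inner_commute)
  then show ?thesis
    using subseq_diagseq by blast
qed

text \<open>The sequence crosses the level upwards infinitely often, and at a crossing the distance to the
  level is at most the length of the step.\<close>

lemma subseq_tendsto_crossed_level:
  fixes g :: "nat \<Rightarrow> real"
  assumes steps: "(\<lambda>n. g (Suc n) - g n) \<longlonglongrightarrow> 0"
    and below: "\<exists>\<^sub>F n in sequentially. g n \<le> c" and above: "\<exists>\<^sub>F n in sequentially. c < g n"
  shows "\<exists>r. strict_mono (r::nat\<Rightarrow>nat) \<and> (g \<circ> r) \<longlonglongrightarrow> c"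
proof -
  define A where "A = {n. g n \<le> c \<and> c < g (Suc n)}"
  have "infinite A"
    unfolding infinite_nat_iff_unbounded_le
  proof
    fix m
    obtain i where i: "i \<ge> m" "g i \<le> c"
      using below by (auto simp: frequently_sequentially)
    obtain j where j: "j \<ge> i" "c < g j"
      using above by (auto simp: frequently_sequentially)
    have "\<exists>n\<ge>i. n \<in> A"
    proof (rule ccontr)
      assume "\<not> ?thesis"
      then have no: "g n \<le> c \<Longrightarrow> g (Suc n) \<le> c" if "n \<ge> i" for n
        using that by (force simp: A_def)
      from j(1) have "g j \<le> c"
        by (induction rule: dec_induct) (use i no in auto)
      with j show False by simp
    qed
    then show "\<exists>n\<ge>m. n \<in> A" using i(1) order_trans by blast
  qed
  then obtain r :: "nat \<Rightarrow> nat" where r: "strict_mono r" "\<And>n. r n \<in> A"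
    using infinite_enumerate by blast
  have "(\<lambda>n. (c - g (r n))) \<longlonglongrightarrow> 0"
  proof (rule tendsto_sandwich[OF _ _ tendsto_const])
    show "(\<lambda>n. g (Suc (r n)) - g (r n)) \<longlonglongrightarrow> 0"
      using LIMSEQ_subseq_LIMSEQ[OF steps r(1)] by (simp add: o_def)
    show "\<forall>\<^sub>F n in sequentially. 0 \<le> c - g (r n)"
      using r(2) by (auto simp: A_def)
    show "\<forall>\<^sub>F n in sequentially. c - g (r n) \<le> g (Suc (r n)) - g (r n)"
      using r(2) by (auto simp: A_def intro!: always_eventually less_imp_le)
  qed
  then have "(\<lambda>n. c - (c - g (r n))) \<longlonglongrightarrow> c - 0"
    by (intro tendsto_intros)
  then show ?thesis using r(1) by (auto simp: o_def)
qed

text \<open>A weak cluster point \<open>p\<close> exists by compactness. If \<open>z n \<bullet> e\<close> did not converge to \<open>p \<bullet> e\<close>, the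
  distance \<open>\<bar>z n \<bullet> e - p \<bullet> e\<bar>\<close> would cross every small level infinitely often, so every small
  level would be the distance of some cluster point, but there are only finitely many of these.\<close>

lemma weakly_convergent_if_finite_cluster_points:
  fixes z :: "nat \<Rightarrow> 'a::{real_inner, complete_space}"
  assumes bdd: "\<And>n. norm (z n) \<le> B"
    and steps: "(\<lambda>n. z (Suc n) - z n) \<longlonglongrightarrow> 0"
    and "finite A"
    and cluster: "\<And>r p. strict_mono r \<Longrightarrow> weakly_converges (z \<circ> r) p \<Longrightarrow> p \<in> A"
  shows "\<exists>p\<in>A. weakly_converges z p"
proof -
  obtain s p where s: "strict_mono (s::nat\<Rightarrow>nat)" and p: "weakly_converges (z \<circ> s) p"
    using bounded_imp_weakly_convergent_subseq[of z B] bdd by blast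
  have "(\<lambda>n. z n \<bullet> e) \<longlonglongrightarrow> p \<bullet> e" for e
  proof (rule ccontr)
    assume not: "\<not> ?thesis"
    define g where "g n = \<bar>z n \<bullet> e - p \<bullet> e\<bar>" for n
    obtain \<epsilon> where \<epsilon>: "\<epsilon> > 0" "\<exists>\<^sub>F n in sequentially. \<epsilon> \<le> g n"
      using not by (auto simp: tendsto_iff not_eventually not_less g_def dist_real_def)
    obtain c where c: "0 < c" "c < \<epsilon>" "c \<notin> (\<lambda>a. \<bar>a \<bullet> e - p \<bullet> e\<bar>) ` A"
    proof -
      have "infinite ({0<..<\<epsilon>} - (\<lambda>a. \<bar>a \<bullet> e - p \<bullet> e\<bar>) ` A)"
        using \<epsilon>(1) \<open>finite A\<close> by (intro Diff_infinite_finite finite_imageI) auto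
      then obtain c where "c \<in> {0<..<\<epsilon>}" "c \<notin> (\<lambda>a. \<bar>a \<bullet> e - p \<bullet> e\<bar>) ` A"
        using infinite_imp_nonempty by blast
      then show ?thesis
        by (intro that[of c]) (unfold greaterThanLessThan_iff, blast+)
    qed
    have "(\<lambda>n. \<bar>(z (Suc n) - z n) \<bullet> e\<bar>) \<longlonglongrightarrow> 0"
      using tendsto_inner[OF steps tendsto_const[of e]] by (simp add: tendsto_rabs_zero)
    then have "(\<lambda>n. g (Suc n) - g n) \<longlonglongrightarrow> 0"
      by (rule Lim_null_comparison[rotated], intro always_eventually allI)
        (unfold g_def real_norm_def inner_diff_left, linarith)
    moreover have "\<exists>\<^sub>F n in sequentially. g n \<le> c"
      unfolding frequently_sequentially
    proof
      fix N
      have "(\<lambda>n. \<bar>z (s n) \<bullet> e - p \<bullet> e\<bar>) \<longlonglongrightarrow> \<bar>p \<bullet> e - p \<bullet> e\<bar>"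
        using p by (intro tendsto_rabs tendsto_diff tendsto_const)
          (simp add: weakly_converges_iff_inner o_def)
      from order_tendstoD(2)[OF this, of c]
      have "\<forall>\<^sub>F n in sequentially. n \<ge> N \<and> g (s n) < c"
        using c(1) by (auto simp: g_def intro: eventually_conj eventually_ge_at_top)
      then obtain n where "n \<ge> N" "g (s n) < c"
        using eventually_happens' sequentially_bot by blast
      then show "\<exists>n\<ge>N. g n \<le> c"
        using seq_suble[OF s, of n] by (intro exI[of _ "s n"]) auto
    qed
    moreover have "\<exists>\<^sub>F n in sequentially. c < g n"
      using \<epsilon>(2) by (rule frequently_elim1) (use c in linarith)
    ultimately obtain r where r: "strict_mono (r::nat\<Rightarrow>nat)" "(g \<circ> r) \<longlonglongrightarrow> c"
      using subseq_tendsto_crossed_level by blast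
    obtain r' q where r': "strict_mono (r'::nat\<Rightarrow>nat)" "weakly_converges ((z \<circ> r) \<circ> r') q"
      using bounded_imp_weakly_convergent_subseq[of "z \<circ> r" B] bdd by auto
    have "q \<in> A"
      using cluster[of "r \<circ> r'" q] r' r(1) by (simp add: o_assoc strict_mono_o)
    have "(\<lambda>n. \<bar>(z \<circ> r \<circ> r') n \<bullet> e - p \<bullet> e\<bar>) \<longlonglongrightarrow> \<bar>q \<bullet> e - p \<bullet> e\<bar>"
      using r'(2) by (intro tendsto_rabs tendsto_diff tendsto_const)
        (simp add: weakly_converges_iff_inner)
    moreover have "(\<lambda>n. \<bar>(z \<circ> r \<circ> r') n \<bullet> e - p \<bullet> e\<bar>) \<longlonglongrightarrow> c"
      using LIMSEQ_subseq_LIMSEQ[OF r(2) r'(1)] by (simp add: o_def g_def)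
    ultimately have "\<bar>q \<bullet> e - p \<bullet> e\<bar> = c"
      using LIMSEQ_unique by blast
    then show False using c(3) \<open>q \<in> A\<close> by blast
  qed
  then have "weakly_converges z p"
    by (simp add: weakly_converges_iff_inner)
  then show ?thesis
    using cluster[OF s p] by blast
qed


section \<open>One iteration\<close>

lemma norm_sq_inertial:
  fixes x x' p :: "'a::real_inner"
  shows "(norm (x + t *\<^sub>R (x - x') - p))\<^sup>2
    = (1 + t) * (norm (x - p))\<^sup>2 - t * (norm (x' - p))\<^sup>2 + t * (1 + t) * (norm (x - x'))\<^sup>2"
proof -
  define a b where "a = x - p" and "b = x' - p"
  have e: "x + t *\<^sub>R (x - x') - p = a + t *\<^sub>R (a - b)" "x - x' = a - b"
    by (simp_all add: a_def b_def)
  show ?thesis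
    unfolding e(1) unfolding e(2) a_def[symmetric] b_def[symmetric]
    by (simp add: power2_norm_eq_inner inner_add_left inner_add_right inner_diff_left
        inner_diff_right inner_commute[of b a] algebra_simps)
qed

text \<open>The obtuse angle at the projection \<open>u\<close> bounds the decrease of the squared distance to \<open>p\<close> from
  below by a multiple of \<open>Fy \<bullet> (u - p)\<close>. The dual inequality replaces \<open>p\<close> by \<open>y\<close> there, and
  membership of \<open>u\<close> in the half-space replaces \<open>(\<beta> * l) *\<^sub>R Fy\<close> by \<open>\<eta>\<close>.
  Completing the square in \<open>w - u - (\<sigma> / \<beta>) d \<eta>\<close> leaves the stated gain, and the
  particular choice of \<open>d\<close> makes \<open>\<eta> \<bullet> (w - y)\<close> equal to \<open>d\<close> times the square of
  the norm of \<open>\<eta>\<close>.\<close>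

lemma extragradient_step:
  fixes w y u p Fw Fy \<eta> :: "'a::real_inner"
  assumes pos: "0 < \<beta>" "0 < \<sigma>" "0 < l" "0 \<le> d"
    and \<eta>: "\<eta> = w - y - (\<beta> * l) *\<^sub>R (Fw - Fy)" "\<eta> \<noteq> 0"
    and d: "d = ((w - y) \<bullet> \<eta>) / (norm \<eta>)\<^sup>2"
    and halfspace: "(w - (\<beta> * l) *\<^sub>R Fw - y) \<bullet> (u - y) \<le> 0"
    and proj: "(w - (\<sigma> * l * d) *\<^sub>R Fy - u) \<bullet> (p - u) \<le> 0"
    and dual: "0 \<le> Fy \<bullet> (y - p)"
  shows "(norm (u - p))\<^sup>2
    \<le> (norm (w - p))\<^sup>2 - (2 * (\<sigma> / \<beta>) - (\<sigma> / \<beta>)\<^sup>2) * (d * norm \<eta>)\<^sup>2"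
proof -
  define k where "k = \<sigma> / \<beta>"
  have k: "k > 0" "\<sigma> = k * \<beta>"
    using pos by (auto simp: k_def)
  have d\<eta>: "\<eta> \<bullet> (w - y) = d * (norm \<eta>)\<^sup>2"
    using \<eta>(2) d by (simp add: inner_commute)
  have 1: "\<eta> \<bullet> (u - y) \<le> (\<beta> * l) * (Fy \<bullet> (u - y))"
  proof -
    have "\<eta> = (w - (\<beta> * l) *\<^sub>R Fw - y) + (\<beta> * l) *\<^sub>R Fy"
      by (simp add: \<eta>(1) algebra_simps)
    then show ?thesis
      using halfspace by (simp add: inner_add_left)
  qed
  have "(w - u) \<bullet> (u - p) \<ge> (\<sigma> * l * d) * (Fy \<bullet> (u - p))"
    using proj by (simp add: inner_diff_left inner_diff_right algebra_simps)
  moreover have "(\<sigma> * l * d) * (Fy \<bullet> (u - p)) \<ge> (\<sigma> * l * d) * (Fy \<bullet> (u - y))"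
    using pos dual by (intro mult_left_mono) (auto simp: inner_diff_right)
  moreover have "(\<sigma> * l * d) * (Fy \<bullet> (u - y)) \<ge> (k * d) * (\<eta> \<bullet> (u - y))"
    using mult_left_mono[OF 1, of "k * d"] k pos by (simp add: mult_ac)
  moreover have "\<eta> \<bullet> (u - y) = d * (norm \<eta>)\<^sup>2 - \<eta> \<bullet> (w - u)"
    using d\<eta> by (simp add: inner_diff_right)
  ultimately have 2: "(w - u) \<bullet> (u - p) \<ge> (k * d) * (d * (norm \<eta>)\<^sup>2 - \<eta> \<bullet> (w - u))"
    by simp
  have 3: "(norm (w - u))\<^sup>2 - 2 * (k * d) * (\<eta> \<bullet> (w - u)) + (k * d)\<^sup>2 * (norm \<eta>)\<^sup>2 \<ge> 0"
  proof -
    have "(norm (w - u - (k * d) *\<^sub>R \<eta>))\<^sup>2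
      = (norm (w - u))\<^sup>2 - 2 * (k * d) * (\<eta> \<bullet> (w - u)) + (k * d)\<^sup>2 * (norm \<eta>)\<^sup>2"
      unfolding power2_norm_eq_inner
      by (simp add: inner_diff_left inner_diff_right inner_commute power2_eq_square algebra_simps)
    then show ?thesis
      by (metis zero_le_power2)
  qed
  have "(norm (w - p))\<^sup>2 = (norm (u - p))\<^sup>2 + (norm (w - u))\<^sup>2 + 2 * ((w - u) \<bullet> (u - p))"
    unfolding power2_norm_eq_inner
    by (simp add: inner_diff_left inner_diff_right inner_commute algebra_simps)
  with 2 3 show ?thesis
    unfolding k_def[symmetric] by (simp add: power2_eq_square algebra_simps)
qed

text \<open>Applied to \<open>s = w - y\<close>, this bounds the quantity \<open>d * norm \<eta>\<close> in the gain of
  \<open>extragradient_step\<close> from below by a multiple of \<open>norm (w - y)\<close>, and shows \<open>0 \<le> d\<close>.\<close>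

lemma relative_perturbation_projection_bound:
  fixes s \<eta> :: "'a::real_inner"
  assumes q: "0 \<le> q" "q < 1" and close: "norm (s - \<eta>) \<le> q * norm s"
  shows "0 \<le> s \<bullet> \<eta>" and "(1 - q) / (1 + q) * norm s \<le> (s \<bullet> \<eta>) / norm \<eta>"
proof -
  have "s \<bullet> (s - \<eta>) \<le> norm s * norm (s - \<eta>)"
    by (rule norm_cauchy_schwarz)
  also have "\<dots> \<le> norm s * (q * norm s)"
    using close by (intro mult_left_mono) auto
  finally have inner: "(1 - q) * (norm s)\<^sup>2 \<le> s \<bullet> \<eta>"
    by (simp add: inner_diff_right power2_norm_eq_inner[symmetric] power2_eq_square algebra_simps)
  moreover have "0 \<le> (1 - q) * (norm s)\<^sup>2"
    using q by simp
  ultimately show nonneg: "0 \<le> s \<bullet> \<eta>" by linarith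
  have up: "norm \<eta> \<le> (1 + q) * norm s"
    using norm_triangle_ineq2[of \<eta> s] close by (simp add: norm_minus_commute algebra_simps)
  show "(1 - q) / (1 + q) * norm s \<le> (s \<bullet> \<eta>) / norm \<eta>"
  proof (cases "\<eta> = 0")
    case True
    then have "norm s \<le> q * norm s" using close by simp
    then have "(1 - q) * norm s \<le> 0" by (simp add: algebra_simps)
    then have "s = 0" using q by (simp add: mult_le_0_iff)
    then show ?thesis by simp
  next
    case False
    have "(1 - q) / (1 + q) * norm s * norm \<eta> \<le> (1 - q) / (1 + q) * norm s * ((1 + q) * norm s)"
      using q up by (intro mult_left_mono) auto
    also have "\<dots> = (1 - q) * (norm s)\<^sup>2"
      using q by (simp add: power2_eq_square)
    finally show ?thesis
      using inner False by (simp add: pos_le_divide_eq)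
  qed
qed

text \<open>The term with \<open>\<theta>\<close> comes from the strong convexity of the squared norm in the averaging step;
  \<open>\<alpha> < 1 / (1 + \<theta>)\<close> says exactly that \<open>(1 - \<alpha>) / \<alpha> > \<theta>\<close>.\<close>

lemma inertial_averaging_step:
  fixes x x' u p :: "'a::real_inner"
  assumes \<alpha>: "0 < \<alpha>" "\<alpha> < 1 / (1 + \<theta>)" and "0 < \<theta>" and \<xi>: "0 \<le> \<xi>" "\<xi> \<le> 1"
    and gain: "(norm (u - p))\<^sup>2 \<le> (norm (x + \<nu> *\<^sub>R (x - x') - p))\<^sup>2 - R"
    and v: "v = x + \<xi> *\<^sub>R (x - x')"
    and z: "z = (1 - \<alpha>) *\<^sub>R v + \<alpha> *\<^sub>R u"
    and \<kappa>: "\<kappa> = (1 - \<alpha>) * \<xi> + \<alpha> * \<nu>"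
    and s: "s = (1 - \<alpha>) * \<xi> * (1 + \<xi>) + \<alpha> * \<nu> * (1 + \<nu>) + \<theta> * \<xi> * (1 - \<xi>)"
  shows "(norm (z - p))\<^sup>2 \<le> (1 + \<kappa>) * (norm (x - p))\<^sup>2 - \<kappa> * (norm (x' - p))\<^sup>2
    + s * (norm (x - x'))\<^sup>2 - \<theta> * (1 - \<xi>) * (norm (z - x))\<^sup>2 - \<alpha> * R"
proof -
  have \<theta>\<alpha>: "\<theta> * \<alpha> \<le> 1 - \<alpha>"
    using \<alpha> \<open>0 < \<theta>\<close> by (simp add: field_simps)
  then have "\<alpha> \<le> 1"
    using \<alpha> \<open>0 < \<theta>\<close> by (smt (verit) mult_pos_pos)
  have "(norm (z - p))\<^sup>2
      = (1 - \<alpha>) * (norm (v - p))\<^sup>2 + \<alpha> * (norm (u - p))\<^sup>2 - \<alpha> * (1 - \<alpha>) * (norm (u - v))\<^sup>2"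
  proof -
    define a b where "a = v - p" and "b = u - p"
    have e: "z - p = (1 - \<alpha>) *\<^sub>R a + \<alpha> *\<^sub>R b" "u - v = b - a"
      by (simp_all add: z a_def b_def algebra_simps)
    show ?thesis
      unfolding e(1) unfolding e(2) a_def[symmetric] b_def[symmetric] power2_norm_eq_inner
      by (simp add: inner_add_left inner_add_right inner_diff_left
          inner_diff_right inner_commute[of b a] algebra_simps)
  qed
  moreover have "\<alpha> * (1 - \<alpha>) * (norm (u - v))\<^sup>2 \<ge> \<theta> * (norm (z - v))\<^sup>2"
  proof -
    have "z - v = \<alpha> *\<^sub>R (u - v)"
      by (simp add: z algebra_simps)
    then have "\<theta> * (norm (z - v))\<^sup>2 = \<alpha> * (\<theta> * \<alpha>) * (norm (u - v))\<^sup>2"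
      by (simp add: power_mult_distrib power2_eq_square)
    also have "\<dots> \<le> \<alpha> * (1 - \<alpha>) * (norm (u - v))\<^sup>2"
      using \<theta>\<alpha> \<alpha> by (intro mult_right_mono mult_left_mono) auto
    finally show ?thesis .
  qed
  moreover have "(norm (z - v))\<^sup>2
      \<ge> (1 - \<xi>) * (norm (z - x))\<^sup>2 - \<xi> * (1 - \<xi>) * (norm (x - x'))\<^sup>2"
  proof -
    define a b where "a = z - x" and "b = x - x'"
    have zv: "z - v = a - \<xi> *\<^sub>R b"
      by (simp add: v a_def b_def algebra_simps)
    have "\<xi> * (norm (a - b))\<^sup>2 \<ge> 0"
      using \<xi> by simp
    moreover have "(norm (a - \<xi> *\<^sub>R b))\<^sup>2
        = (1 - \<xi>) * (norm a)\<^sup>2 - \<xi> * (1 - \<xi>) * (norm b)\<^sup>2 + \<xi> * (norm (a - b))\<^sup>2"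
      unfolding power2_norm_eq_inner
      by (simp add: inner_diff_left inner_diff_right inner_commute[of b a] algebra_simps)
    ultimately show ?thesis
      unfolding zv a_def[symmetric] b_def[symmetric] by linarith
  qed
  then have "\<theta> * (norm (z - v))\<^sup>2
      \<ge> \<theta> * ((1 - \<xi>) * (norm (z - x))\<^sup>2 - \<xi> * (1 - \<xi>) * (norm (x - x'))\<^sup>2)"
    using \<open>0 < \<theta>\<close> by simp
  moreover have "\<alpha> * (norm (u - p))\<^sup>2 \<le> \<alpha> * ((norm (x + \<nu> *\<^sub>R (x - x') - p))\<^sup>2 - R)"
    using gain \<alpha> by simp
  ultimately have "(norm (z - p))\<^sup>2 \<le> (1 - \<alpha>) * (norm (v - p))\<^sup>2
      + \<alpha> * ((norm (x + \<nu> *\<^sub>R (x - x') - p))\<^sup>2 - R)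
      - \<theta> * ((1 - \<xi>) * (norm (z - x))\<^sup>2 - \<xi> * (1 - \<xi>) * (norm (x - x'))\<^sup>2)"
    by linarith
  also have "\<dots> = (1 + \<kappa>) * (norm (x - p))\<^sup>2 - \<kappa> * (norm (x' - p))\<^sup>2
      + s * (norm (x - x'))\<^sup>2 - \<theta> * (1 - \<xi>) * (norm (z - x))\<^sup>2 - \<alpha> * R"
    unfolding v norm_sq_inertial \<kappa> s by (simp add: algebra_simps)
  finally show ?thesis .
qed

section \<open>Real sequences\<close>

text \<open>The logarithm of \<open>l\<close> minus the partial sums of \<open>r\<close> is decreasing and bounded below, so the
  logarithms converge.\<close>

lemma ratio_tendsto_1_of_summable_growth:
  fixes l r :: "nat \<Rightarrow> real"
  assumes "0 < m" and low: "\<And>n. m \<le> l n"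
    and growth: "\<And>n. l (Suc n) \<le> (1 + r n) * l n"
    and r: "\<And>n. 0 \<le> r n" "summable r"
  shows "(\<lambda>n. l n / l (Suc n)) \<longlonglongrightarrow> 1"
proof -
  have pos: "l n > 0" for n
    using low[of n] \<open>0 < m\<close> by linarith
  define S where "S n = ln (l n) - sum r {..<n}" for n
  have "S (Suc n) \<le> S n" for n
  proof -
    have "ln (l (Suc n)) \<le> ln ((1 + r n) * l n)"
      using growth[of n] pos by (intro ln_mono) auto
    also have "\<dots> = ln (1 + r n) + ln (l n)"
      using pos[of n] r(1)[of n] by (simp add: ln_mult)
    also have "\<dots> \<le> r n + ln (l n)"
      using ln_add_one_self_le_self[OF r(1)[of n]] by simp
    finally show ?thesis by (simp add: S_def)
  qed
  then have "decseq S" by (rule decseq_SucI)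
  moreover have "ln m - suminf r \<le> S n" for n
    using low[of n] \<open>0 < m\<close> pos[of n] sum_le_suminf[OF r(2), of "{..<n}"] r(1)
    by (auto simp: S_def intro!: diff_mono)
  ultimately obtain L where "S \<longlonglongrightarrow> L"
    using decseq_convergent by blast
  then have "(\<lambda>n. S n + sum r {..<n}) \<longlonglongrightarrow> L + suminf r"
    by (intro tendsto_add summable_LIMSEQ r)
  then have lim: "(\<lambda>n. ln (l n)) \<longlonglongrightarrow> L + suminf r"
    by (simp add: S_def)
  have "(\<lambda>n. exp (ln (l n) - ln (l (Suc n)))) \<longlonglongrightarrow> exp (L + suminf r - (L + suminf r))"
    using lim by (intro tendsto_intros LIMSEQ_Suc)
  then show ?thesis
    using pos by (simp add: exp_diff)
qed

text \<open>Monotonicity of \<open>\<kappa>\<close> makes \<open>\<Gamma> n = a (Suc n) - \<kappa> n * a n + s n * D n\<close> decrease, by at least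
  \<open>\<epsilon> * D (Suc n) + R n\<close> at each step. As \<open>\<kappa>\<close> stays below 1, the upper bound on \<open>\<Gamma>\<close> is a
  contractive recursion that bounds \<open>a\<close>; this bounds \<open>\<Gamma>\<close> from below, so that its decrements
  are summable.\<close>

lemma inertial_lyapunov:
  fixes a D R \<kappa> s t :: "nat \<Rightarrow> real"
  assumes nonneg: "\<And>n. 0 \<le> a n" "\<And>n. 0 \<le> D n" "\<And>n. 0 \<le> R n" "\<And>n. 0 \<le> s n" "\<And>n. 0 \<le> \<kappa> n"
    and \<kappa>: "\<And>n. \<kappa> n \<le> \<kappa> (Suc n)" "\<And>n. \<kappa> n \<le> K" "K < 1"
    and rec: "\<And>n. a (Suc (Suc n))
      \<le> (1 + \<kappa> n) * a (Suc n) - \<kappa> n * a n + s n * D n - t n * D (Suc n) - R n"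
    and \<epsilon>: "0 < \<epsilon>" "\<And>n. \<epsilon> + s (Suc n) \<le> t n"
  shows "\<exists>B. \<forall>n. a n \<le> B" and "D \<longlonglongrightarrow> 0" and "R \<longlonglongrightarrow> 0"
proof -
  define \<Gamma> where "\<Gamma> n = a (Suc n) - \<kappa> n * a n + s n * D n" for n
  have dec: "\<Gamma> (Suc n) + (\<epsilon> * D (Suc n) + R n) \<le> \<Gamma> n" for n
  proof -
    have "\<kappa> n * a (Suc n) \<le> \<kappa> (Suc n) * a (Suc n)"
      using \<kappa> nonneg by (intro mult_right_mono) auto
    moreover have "(\<epsilon> + s (Suc n)) * D (Suc n) \<le> t n * D (Suc n)"
      using \<epsilon>(2) nonneg by (intro mult_right_mono) auto
    ultimately show ?thesis
      using rec[of n] by (simp add: \<Gamma>_def algebra_simps)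
  qed
  have tele: "\<Gamma> n + (\<Sum>k<n. \<epsilon> * D (Suc k) + R k) \<le> \<Gamma> 0" for n
  proof (induction n)
    case (Suc n)
    then show ?case using dec[of n] by simp
  qed simp
  have sum_nonneg: "0 \<le> (\<Sum>k<n. \<epsilon> * D (Suc k) + R k)" for n
    using nonneg \<epsilon>(1) by (intro sum_nonneg) simp
  define G where "G = max (\<Gamma> 0) 0"
  have K0: "0 \<le> K" using nonneg(5)[of 0] \<kappa>(2)[of 0] by linarith
  define B where "B = a 0 + G / (1 - K)"
  have bound: "a n \<le> B" for n
  proof (induction n)
    case 0
    then show ?case using \<kappa>(3) by (simp add: B_def G_def)
  next
    case (Suc n)
    have "a (Suc n) \<le> \<Gamma> n + \<kappa> n * a n"
      using nonneg(2,4) by (simp add: \<Gamma>_def)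
    also have "\<dots> \<le> G + K * a n"
      using tele[of n] sum_nonneg[of n] nonneg \<kappa> unfolding G_def
      by (intro add_mono mult_right_mono) auto
    also have "\<dots> \<le> G + K * B"
      using Suc K0 by (intro add_left_mono mult_left_mono)
    also have "\<dots> = K * a 0 + G / (1 - K)"
      using \<kappa>(3) by (simp add: B_def field_simps)
    also have "\<dots> \<le> B"
      using nonneg(1)[of 0] \<kappa>(3) mult_right_mono[of K 1 "a 0"] by (simp add: B_def)
    finally show ?case .
  qed
  then show "\<exists>B. \<forall>n. a n \<le> B" by blast
  have "summable (\<lambda>k. \<epsilon> * D (Suc k) + R k)"
  proof (rule summableI_nonneg_bounded)
    show "0 \<le> \<epsilon> * D (Suc n) + R n" for n
      using nonneg \<epsilon>(1) by simp
    show "(\<Sum>k<n. \<epsilon> * D (Suc k) + R k) \<le> \<Gamma> 0 + K * B" for n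
    proof -
      have "- (\<kappa> n * a n) \<le> \<Gamma> n"
        using nonneg by (simp add: \<Gamma>_def)
      moreover have "\<kappa> n * a n \<le> K * B"
        using \<kappa> bound nonneg K0 by (intro mult_mono) auto
      ultimately show ?thesis using tele[of n] by linarith
    qed
  qed
  then have lim: "(\<lambda>k. \<epsilon> * D (Suc k) + R k) \<longlonglongrightarrow> 0"
    by (rule summable_LIMSEQ_zero)
  show "R \<longlonglongrightarrow> 0"
    by (rule tendsto_sandwich[OF _ _ tendsto_const lim]) (use nonneg \<epsilon>(1) in auto)
  have "(\<lambda>k. \<epsilon> * D (Suc k)) \<longlonglongrightarrow> 0"
    by (rule tendsto_sandwich[OF _ _ tendsto_const lim]) (use nonneg \<epsilon>(1) in auto)
  then have "(\<lambda>k. inverse \<epsilon> * (\<epsilon> * D (Suc k))) \<longlonglongrightarrow> inverse \<epsilon> * 0"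
    by (intro tendsto_intros)
  then show "D \<longlonglongrightarrow> 0"
    using \<epsilon>(1) by (simp add: filterlim_sequentially_Suc)
qed

section \<open>Weak limits solve the variational inequality\<close>

text \<open>The obtuse angle at \<open>y n\<close>, the Lipschitz condition and \<open>w n - y n \<longlonglongrightarrow> 0\<close> give
  \<open>F (y n) \<bullet> y n \<le> F (y n) \<bullet> q\<close> up to a null sequence. The right-hand side converges to \<open>F p \<bullet> q\<close>, but
  the left-hand side is a product of two weakly convergent sequences. Taking \<open>q = p\<close> bounds its
  limsup by \<open>F p \<bullet> p\<close>, which is what the hypothesis on \<open>F\<close> needs to identify its limit.\<close>

lemma weak_limit_mem_VI:
  fixes C :: "'a::{real_inner, complete_space} set"
  assumes C: "closed C" "convex C"
    and F: "L-lipschitz_on UNIV F" "seq_weakly_continuous_on C F"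
    and A3: "\<And>z p. weakly_converges z p \<Longrightarrow>
               limsup (\<lambda>n. ereal (F (z n) \<bullet> z n)) \<le> ereal (F p \<bullet> p) \<Longrightarrow>
               (\<lambda>n. F (z n) \<bullet> z n) \<longlonglongrightarrow> F p \<bullet> p"
    and y: "\<And>n. y n \<in> C"
    and var: "\<And>n q. q \<in> C \<Longrightarrow> (w n - t n *\<^sub>R F (w n) - y n) \<bullet> (q - y n) \<le> 0"
    and t: "0 < m" "\<And>n. m \<le> t n"
    and wy: "(\<lambda>n. w n - y n) \<longlonglongrightarrow> 0" and bdd: "\<And>n. norm (y n) \<le> B"
    and weak: "weakly_converges y p"
  shows "p \<in> VI C F"
proof -
  have L: "0 \<le> L" using F(1) by (rule lipschitz_on_nonneg)
  have pC: "p \<in> C"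
    using closed_convex_weakly_sequentially_closed[OF C y weak] .
  have "weakly_converges (\<lambda>n. F (y n)) (F p)"
    using F(2) y pC weak by (auto simp: seq_weakly_continuous_on_def)
  then have Fy: "(\<lambda>n. F (y n) \<bullet> q) \<longlonglongrightarrow> F p \<bullet> q" for q
    by (simp add: weakly_converges_iff_inner)
  define err where "err q n = (1 / m + L) * norm (w n - y n) * (B + norm q)" for q :: 'a and n
  have err: "(\<lambda>n. err q n) \<longlonglongrightarrow> 0" for q
    unfolding err_def
    by (rule tendsto_eq_intros tendsto_norm_zero[OF wy] refl)+ simp
  have upper: "F (y n) \<bullet> y n \<le> F (y n) \<bullet> q + err q n" if "q \<in> C" for q n
  proof -
    let ?e = "norm (w n - y n)" and ?f = "norm (y n - q)"
    have tpos: "0 < t n" using t(1) t(2)[of n] by linarith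
    have f: "?f \<le> B + norm q"
      using norm_triangle_ineq4[of "y n" q] bdd[of n] by linarith
    have "t n * (F (w n) \<bullet> (y n - q)) \<le> (w n - y n) \<bullet> (y n - q)"
      using var[OF that, of n] by (simp add: inner_diff_left inner_diff_right algebra_simps)
    also have "\<dots> \<le> ?e * ?f"
      by (rule norm_cauchy_schwarz)
    finally have "F (w n) \<bullet> (y n - q) \<le> ?e * ?f / t n"
      using tpos by (simp add: field_simps)
    also have "\<dots> \<le> ?e * ?f / m"
      using t tpos by (intro divide_left_mono) auto
    finally have 1: "F (w n) \<bullet> (y n - q) \<le> ?e * ?f / m" .
    have "(F (y n) - F (w n)) \<bullet> (y n - q) \<le> norm (F (y n) - F (w n)) * ?f"
      by (rule norm_cauchy_schwarz)
    also have "\<dots> \<le> (L * ?e) * ?f"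
      using lipschitz_onD[OF F(1), of "y n" "w n"]
      by (intro mult_right_mono) (auto simp: dist_norm norm_minus_commute)
    finally have "F (y n) \<bullet> (y n - q) \<le> (1 / m + L) * ?e * ?f"
      using 1 by (simp add: inner_diff_left algebra_simps)
    also have "\<dots> \<le> err q n"
      unfolding err_def using f t L by (intro mult_left_mono) auto
    finally show ?thesis by (simp add: inner_diff_right)
  qed
  have "limsup (\<lambda>n. ereal (F (y n) \<bullet> y n)) \<le> limsup (\<lambda>n. ereal (F (y n) \<bullet> p + err p n))"
    using upper[OF pC] by (intro Limsup_mono always_eventually) auto
  also have "\<dots> = ereal (F p \<bullet> p)"
    using tendsto_add[OF Fy[of p] err[of p]] by (intro lim_imp_Limsup) auto
  finally have lim: "(\<lambda>n. F (y n) \<bullet> y n) \<longlonglongrightarrow> F p \<bullet> p"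
    using A3[OF weak] by blast
  have "F p \<bullet> (q - p) \<ge> 0" if "q \<in> C" for q
  proof -
    have "F p \<bullet> p \<le> F p \<bullet> q + 0"
      by (rule LIMSEQ_le[OF lim tendsto_add[OF Fy[of q] err[of q]]]) (use upper[OF that] in auto)
    then show ?thesis by (simp add: inner_diff_right)
  qed
  then show ?thesis using pC by (simp add: VI_def)
qed


section \<open>Convergence of the algorithm\<close>

text \<open>This is the condition linking the coefficients of consecutive squared steps in the Lyapunov
  argument. The margin \<open>\<theta> * (1 - z)\<^sup>2 - 2\<close> is positive exactly if \<open>z < (\<theta> - sqrt (2 * \<theta>)) / \<theta>\<close>,
  for \<open>z \<le> 1\<close>, which is the bound imposed on the inertial weights. The 2 comes from
  \<open>\<xi>' * (1 + \<xi>') \<le> 2\<close> and \<open>\<nu> * (1 + \<nu>) \<le> 2\<close>, averaged with the weights \<open>1 - \<alpha>\<close> and \<open>\<alpha>\<close>.\<close>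

lemma inertial_weights_margin:
  fixes \<theta> :: real
  assumes "0 < \<theta>" "0 \<le> \<xi>" "\<xi> \<le> \<xi>'" "\<xi>' \<le> z" "z \<le> 1" "0 \<le> \<alpha>" "\<alpha> \<le> 1" "0 \<le> \<nu>" "\<nu> \<le> 1"
  shows "\<theta> * (1 - z)\<^sup>2 - 2
    + ((1 - \<alpha>) * \<xi>' * (1 + \<xi>') + \<alpha> * \<nu> * (1 + \<nu>) + \<theta> * \<xi>' * (1 - \<xi>')) \<le> \<theta> * (1 - \<xi>)"
proof -
  have "\<xi>' * (1 + \<xi>') \<le> 1 * 2" "\<nu> * (1 + \<nu>) \<le> 1 * 2"
    using assms by (intro mult_mono; simp)+
  then have "(1 - \<alpha>) * (\<xi>' * (1 + \<xi>')) \<le> (1 - \<alpha>) * 2" "\<alpha> * (\<nu> * (1 + \<nu>)) \<le> \<alpha> * 2"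
    using assms by (intro mult_left_mono; simp)+
  moreover have "\<theta> * (1 - z)\<^sup>2 \<le> \<theta> * (1 - \<xi>')\<^sup>2"
    using assms by (intro mult_left_mono power_mono) auto
  moreover have "\<theta> * (1 - \<xi>')\<^sup>2 + \<theta> * \<xi>' * (1 - \<xi>') = \<theta> * (1 - \<xi>')"
    by (simp add: power2_eq_square algebra_simps)
  moreover have "\<theta> * (1 - \<xi>') \<le> \<theta> * (1 - \<xi>)"
    using assms by simp
  ultimately show ?thesis by (simp add: mult.assoc)
qed

lemma tendsto_zero_of_norm_sq:
  fixes f :: "nat \<Rightarrow> 'a::real_normed_vector"
  assumes "(\<lambda>n. (norm (f n))\<^sup>2) \<longlonglongrightarrow> 0"
  shows "f \<longlonglongrightarrow> 0"
  using tendsto_real_sqrt[OF assms] by (simp add: tendsto_norm_zero_iff)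

theorem theorem4p1:
  fixes C :: "'a::{real_inner, complete_space} set"
    and F :: "'a \<Rightarrow> 'a"
    and L \<theta> \<xi>\<^sub>u \<alpha>\<^sub>l \<mu> \<sigma> \<beta> :: real
    and \<nu> \<xi> \<alpha> \<delta> chi \<zeta> lam d :: "nat \<Rightarrow> real"
    and x w y u v \<eta> :: "nat \<Rightarrow> 'a"
    and T :: "nat \<Rightarrow> 'a set"
  assumes C: "C \<noteq> {}" "closed C" "convex C"
    and A1: "L > 0" "L-lipschitz_on UNIV F" "seq_weakly_continuous_on C F"
    and A2: "dual_VI C F \<noteq> {}"
    and A3: "\<And>z p. weakly_converges z p \<Longrightarrow>
               limsup (\<lambda>n. ereal (F (z n) \<bullet> z n)) \<le> ereal (F p \<bullet> p) \<Longrightarrow>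
               (\<lambda>n. F (z n) \<bullet> z n) \<longlonglongrightarrow> F p \<bullet> p"
    and \<theta>: "\<theta> > 2"
    and A4: "\<And>n. n \<ge> 1 \<Longrightarrow> 0 \<le> \<nu> n \<and> \<nu> n \<le> \<nu> (n + 1) \<and> \<nu> (n + 1) \<le> 1"
    and A5: "\<And>n. n \<ge> 1 \<Longrightarrow> 0 \<le> \<xi> n \<and> \<xi> n \<le> \<xi> (n + 1) \<and> \<xi> (n + 1) \<le> \<xi>\<^sub>u"
            "\<xi>\<^sub>u < min ((\<theta> - sqrt (2 * \<theta>)) / \<theta>) (\<nu> 1)"
    and A6: "0 < \<alpha>\<^sub>l"
            "\<And>n. n \<ge> 1 \<Longrightarrow> \<alpha>\<^sub>l \<le> \<alpha> n \<and> \<alpha> n \<le> \<alpha> (n + 1) \<and> \<alpha> (n + 1) < 1 / (1 + \<theta>)"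
    and A7: "\<And>n. n \<ge> 1 \<Longrightarrow> \<delta> n \<ge> 1" "\<delta> \<longlonglongrightarrow> 1"
            "\<And>n. n \<ge> 1 \<Longrightarrow> chi n \<ge> 1" "summable (\<lambda>n. chi (n + 1) - 1)"
            "\<And>n. \<zeta> n \<ge> 0" "summable \<zeta>"
    and params: "0 < \<mu>" "\<mu> < 1" "lam 1 > 0" "0 < \<sigma>" "\<sigma> < 2 / \<mu>" "\<sigma> / 2 < \<beta>" "\<beta> < 1 / \<mu>"
    and w: "\<And>n. n \<ge> 1 \<Longrightarrow> w n = x n + \<nu> n *\<^sub>R (x n - x (n - 1))"
    and y: "\<And>n. n \<ge> 1 \<Longrightarrow> y n = metric_proj C (w n - (\<beta> * lam n) *\<^sub>R F (w n))"
    and lam: "\<And>n. n \<ge> 1 \<Longrightarrow> lam (n + 1) =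
               (if F (w n) \<noteq> F (y n)
                then min (\<mu> * \<delta> n * norm (w n - y n) / norm (F (w n) - F (y n)))
                         (chi n * lam n + \<zeta> n)
                else chi n * lam n + \<zeta> n)"
    and no_stop: "\<And>n. n \<ge> 1 \<Longrightarrow> w n \<noteq> y n \<and> F (y n) \<noteq> 0"
    and T: "\<And>n. n \<ge> 1 \<Longrightarrow> T n = {q. (w n - (\<beta> * lam n) *\<^sub>R F (w n) - y n) \<bullet> (q - y n) \<le> 0}"
    and \<eta>: "\<And>n. n \<ge> 1 \<Longrightarrow> \<eta> n = w n - y n - (\<beta> * lam n) *\<^sub>R (F (w n) - F (y n))"
    and \<eta>_nonzero: "\<And>n. n \<ge> 1 \<Longrightarrow> \<eta> n \<noteq> 0"
    and d: "\<And>n. n \<ge> 1 \<Longrightarrow> d n = ((w n - y n) \<bullet> \<eta> n) / (norm (\<eta> n))\<^sup>2"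
    and u: "\<And>n. n \<ge> 1 \<Longrightarrow> u n = metric_proj (T n) (w n - (\<sigma> * lam n * d n) *\<^sub>R F (y n))"
    and v: "\<And>n. n \<ge> 1 \<Longrightarrow> v n = x n + \<xi> n *\<^sub>R (x n - x (n - 1))"
    and x: "\<And>n. n \<ge> 1 \<Longrightarrow> x (n + 1) = (1 - \<alpha> n) *\<^sub>R v n + \<alpha> n *\<^sub>R u n"
    and finite_VI: "finite (VI C F)"
  shows "\<exists>p \<in> VI C F. weakly_converges x p"
proof -
  obtain p where p: "p \<in> C" "\<And>q. q \<in> C \<Longrightarrow> 0 \<le> F q \<bullet> (q - p)"
    using A2 by (auto simp: dual_VI_def)
  have lip: "norm (F a - F b) \<le> L * norm (a - b)" for a b
    using lipschitz_onD[OF A1(2), of a b] by (simp add: dist_norm)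

  \<comment> \<open>By the Lipschitz condition the quotient in the rule for \<open>lam\<close> is at least \<open>\<mu> / L\<close>, and the
      alternative never decreases \<open>lam\<close>.\<close>
  define m where "m = min (\<mu> / L) (lam 1)"
  have m: "m > 0"
    using params A1(1) by (simp add: m_def)
  have low: "m \<le> lam n" if "n \<ge> 1" for n
    using that
  proof (induction n rule: dec_induct)
    case base
    then show ?case by (simp add: m_def)
  next
    case (step n)
    have "1 * lam n + 0 \<le> chi n * lam n + \<zeta> n"
      using A7(3)[of n] A7(5)[of n] step m by (intro add_mono mult_right_mono) auto
    then have 1: "m \<le> chi n * lam n + \<zeta> n"
      using step by simp
    have 2: "m \<le> \<mu> * \<delta> n * norm (w n - y n) / norm (F (w n) - F (y n))" if "F (w n) \<noteq> F (y n)"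
    proof -
      have "\<mu> / L * norm (F (w n) - F (y n)) \<le> \<mu> / L * (L * norm (w n - y n))"
        using lip params A1(1) by (intro mult_left_mono) auto
      also have "\<dots> = \<mu> * 1 * norm (w n - y n)"
        using A1(1) by simp
      also have "\<dots> \<le> \<mu> * \<delta> n * norm (w n - y n)"
        using A7(1)[of n] step params by (intro mult_right_mono mult_left_mono) auto
      finally have "\<mu> / L \<le> \<mu> * \<delta> n * norm (w n - y n) / norm (F (w n) - F (y n))"
        using that by (simp add: pos_le_divide_eq)
      then show ?thesis by (simp add: m_def)
    qed
    show ?case
      using lam[of n] step 1 2 by simp
  qed
  have lam_pos: "lam n > 0" if "n \<ge> 1" for n
    using low[OF that] m by linarith
  have "(\<lambda>k. lam (Suc k) / lam (Suc (Suc k))) \<longlonglongrightarrow> 1"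
  proof (rule ratio_tendsto_1_of_summable_growth[OF m, where r = "\<lambda>k. chi (k + 1) - 1 + \<zeta> (k + 1) / m"])
    show "m \<le> lam (Suc k)" for k
      using low by simp
    show "lam (Suc (Suc k)) \<le> (1 + (chi (k + 1) - 1 + \<zeta> (k + 1) / m)) * lam (Suc k)" for k
    proof -
      have "lam (Suc (Suc k)) \<le> chi (Suc k) * lam (Suc k) + \<zeta> (Suc k)"
        using lam[of "Suc k"] by auto
      also have "\<zeta> (Suc k) \<le> \<zeta> (Suc k) / m * lam (Suc k)"
        using mult_left_mono[OF low[of "Suc k"], of "\<zeta> (Suc k) / m"] m A7(5)[of "Suc k"] by simp
      finally show ?thesis by (simp add: algebra_simps)
    qed
    show "0 \<le> chi (k + 1) - 1 + \<zeta> (k + 1) / m" for k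
      using A7(3)[of "k + 1"] A7(5)[of "k + 1"] m by simp
    have "summable (\<lambda>k. \<zeta> (k + 1))"
      using A7(6) by (simp add: summable_Suc_iff)
    then show "summable (\<lambda>k. chi (k + 1) - 1 + \<zeta> (k + 1) / m)"
      using A7(4) by (intro summable_add summable_divide)
  qed
  then have ratio: "(\<lambda>n. lam n / lam (Suc n)) \<longlonglongrightarrow> 1"
    using filterlim_sequentially_Suc by blast

  \<comment> \<open>Any number strictly between \<open>\<beta> * \<mu>\<close> and 1 serves as bound for the relative perturbation.\<close>
  define q where "q = (1 + \<beta> * \<mu>) / 2"
  have "0 < \<beta>" using params by linarith
  have "\<beta> * \<mu> < 1" using params by (simp add: field_simps)
  then have q: "0 \<le> q" "q < 1" "\<beta> * \<mu> < q"
    using \<open>0 < \<beta>\<close> params by (auto simp: q_def)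
  have "(\<lambda>n. \<beta> * (\<mu> * \<delta> n * (lam n / lam (Suc n)))) \<longlonglongrightarrow> \<beta> * (\<mu> * 1 * 1)"
    by (intro tendsto_mult tendsto_const A7(2) ratio)
  then have "\<forall>\<^sub>F n in sequentially. \<beta> * (\<mu> * \<delta> n * (lam n / lam (Suc n))) < q"
    using order_tendstoD(2) q(3) by fastforce
  then obtain M where M: "\<And>n. n \<ge> M \<Longrightarrow> \<beta> * (\<mu> * \<delta> n * (lam n / lam (Suc n))) < q"
    by (auto simp: eventually_sequentially)
  define \<rho> where "\<rho> = (1 - q) / (1 + q)"
  have "\<rho> > 0" using q by (simp add: \<rho>_def)

  have close: "norm ((w n - y n) - \<eta> n) \<le> q * norm (w n - y n)" if n: "n \<ge> 1" "n \<ge> M" for n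
  proof -
    have "norm (F (w n) - F (y n)) * lam (Suc n) \<le> \<mu> * \<delta> n * norm (w n - y n)"
    proof (cases "F (w n) = F (y n)")
      case True
      then show ?thesis using params A7(1)[of n] n by simp
    next
      case False
      then have "lam (Suc n) \<le> \<mu> * \<delta> n * norm (w n - y n) / norm (F (w n) - F (y n))"
        using lam[OF n(1)] by simp
      then show ?thesis using False by (simp add: pos_le_divide_eq mult.commute)
    qed
    then have "norm (F (w n) - F (y n)) \<le> \<mu> * \<delta> n * norm (w n - y n) / lam (Suc n)"
      using lam_pos[of "Suc n"] by (simp add: pos_le_divide_eq)
    then have "\<beta> * lam n * norm (F (w n) - F (y n))
        \<le> \<beta> * lam n * (\<mu> * \<delta> n * norm (w n - y n) / lam (Suc n))"
      using \<open>0 < \<beta>\<close> lam_pos[OF n(1)] by (intro mult_left_mono) auto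
    also have "\<dots> = (\<beta> * (\<mu> * \<delta> n * (lam n / lam (Suc n)))) * norm (w n - y n)"
      by simp
    also have "\<dots> \<le> q * norm (w n - y n)"
      using M[OF n(2)] by (intro mult_right_mono) auto
    finally show ?thesis
      using \<eta>[OF n(1)] \<open>0 < \<beta>\<close> lam_pos[OF n(1)] by (simp add: abs_mult)
  qed
  have d\<eta>: "d n * norm (\<eta> n) = ((w n - y n) \<bullet> \<eta> n) / norm (\<eta> n)" if "n \<ge> 1" for n
    using d[OF that] \<eta>_nonzero[OF that] by (simp add: power2_eq_square)
  have d_nonneg: "0 \<le> d n" and d_low: "\<rho> * norm (w n - y n) \<le> d n * norm (\<eta> n)"
    if "n \<ge> 1" "n \<ge> M" for n
    using relative_perturbation_projection_bound[OF q(1,2) close[OF that]] d d\<eta> that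
    by (auto simp: \<rho>_def)

  have yC: "y n \<in> C" if "n \<ge> 1" for n
    using metric_proj_mem[OF C] y[OF that] by simp
  have var: "(w n - (\<beta> * lam n) *\<^sub>R F (w n) - y n) \<bullet> (b - y n) \<le> 0" if "n \<ge> 1" "b \<in> C" for n b
    using metric_proj_obtuse[OF C that(2)] y[OF that(1)] by simp
  define c where "c = 2 * (\<sigma> / \<beta>) - (\<sigma> / \<beta>)\<^sup>2"
  have "c > 0"
  proof -
    have "0 < \<sigma> / \<beta>" "\<sigma> / \<beta> < 2"
      using params \<open>0 < \<beta>\<close> by (auto simp: field_simps)
    then have "0 < (\<sigma> / \<beta>) * (2 - \<sigma> / \<beta>)" by (intro mult_pos_pos) auto
    then show ?thesis by (simp add: c_def power2_eq_square algebra_simps)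
  qed
  have gain: "(norm (u n - p))\<^sup>2 \<le> (norm (w n - p))\<^sup>2 - c * (d n * norm (\<eta> n))\<^sup>2"
    if n: "n \<ge> 1" "n \<ge> M" for n
  proof -
    let ?a = "w n - (\<beta> * lam n) *\<^sub>R F (w n) - y n"
    have "T n = {b. ?a \<bullet> b \<le> ?a \<bullet> y n}"
      using T[OF n(1)] by (simp add: inner_diff_right)
    then have "closed (T n)" "convex (T n)"
      by (simp_all add: closed_halfspace_le convex_halfspace_le)
    moreover have "y n \<in> T n"
      using T[OF n(1)] by simp
    then have "T n \<noteq> {}" by blast
    moreover have "p \<in> T n"
      using T[OF n(1)] var[OF n(1) p(1)] by simp
    ultimately have "u n \<in> T n" "(w n - (\<sigma> * lam n * d n) *\<^sub>R F (y n) - u n) \<bullet> (p - u n) \<le> 0"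
      using metric_proj_mem[of "T n"] metric_proj_obtuse[of "T n"] u[OF n(1)] by auto
    then show ?thesis
      unfolding c_def
      using T[OF n(1)] p(2)[OF yC[OF n(1)]]
      by (intro extragradient_step[OF \<open>0 < \<beta>\<close> params(4) lam_pos[OF n(1)] d_nonneg[OF n]
            \<eta>[OF n(1)] \<eta>_nonzero[OF n(1)] d[OF n(1)]]) simp_all
  qed

  have \<xi>\<^sub>u: "0 \<le> \<xi>\<^sub>u" "\<xi>\<^sub>u < 1" "\<xi>\<^sub>u < \<nu> 1" and margin: "0 < \<theta> * (1 - \<xi>\<^sub>u)\<^sup>2 - 2"
  proof -
    show "0 \<le> \<xi>\<^sub>u" using A5(1)[of 1] by linarith
    show "\<xi>\<^sub>u < \<nu> 1" using A5(2) by simp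
    have s: "sqrt (2 * \<theta>) < \<theta> * (1 - \<xi>\<^sub>u)"
      using A5(2) \<theta> by (simp add: field_simps)
    moreover have "0 < sqrt (2 * \<theta>)" using \<theta> by simp
    ultimately have "0 < \<theta> * (1 - \<xi>\<^sub>u)" by linarith
    then show "\<xi>\<^sub>u < 1" using \<theta> by (simp add: zero_less_mult_iff)
    have "(sqrt (2 * \<theta>))\<^sup>2 < (\<theta> * (1 - \<xi>\<^sub>u))\<^sup>2"
      using s \<theta> by (intro power_strict_mono) auto
    then have "\<theta> * 2 < \<theta> * (\<theta> * (1 - \<xi>\<^sub>u)\<^sup>2)"
      using \<theta> by (simp add: power_mult_distrib power2_eq_square mult_ac)
    then show "0 < \<theta> * (1 - \<xi>\<^sub>u)\<^sup>2 - 2"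
      using \<theta> by simp
  qed
  have \<xi>b: "0 \<le> \<xi> n" "\<xi> n \<le> \<xi> (Suc n)" "\<xi> n \<le> \<xi>\<^sub>u" if "n \<ge> 1" for n
    using A5(1)[OF that] by auto
  have \<alpha>b: "\<alpha>\<^sub>l \<le> \<alpha> n" "\<alpha> n \<le> \<alpha> (Suc n)" "\<alpha> n < 1 / (1 + \<theta>)" "0 < \<alpha> n" "\<alpha> n \<le> 1" if "n \<ge> 1" for n
  proof -
    show "\<alpha>\<^sub>l \<le> \<alpha> n" "\<alpha> n \<le> \<alpha> (Suc n)" "\<alpha> n < 1 / (1 + \<theta>)" "0 < \<alpha> n"
      using A6(1) A6(2)[OF that] by auto
    moreover have "1 / (1 + \<theta>) \<le> 1" using \<theta> by simp
    ultimately show "\<alpha> n \<le> 1" by linarith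
  qed
  have \<nu>b: "\<nu> 1 \<le> \<nu> n" "\<nu> n \<le> \<nu> (Suc n)" "\<nu> n \<le> 1" "0 \<le> \<nu> n" if "n \<ge> 1" for n
  proof -
    show "\<nu> n \<le> \<nu> (Suc n)" "\<nu> n \<le> 1" "0 \<le> \<nu> n" using A4[OF that] by auto
    show "\<nu> 1 \<le> \<nu> n"
      using that by (induction n rule: dec_induct) (use A4 in force)+
  qed

  \<comment> \<open>The sequences for the Lyapunov argument start with \<open>x M\<close>, which is \<open>x (n - 1)\<close> for the first
      iteration \<open>n = N\<close>; so \<open>a\<close> and \<open>D\<close> are indexed from \<open>M\<close>, the coefficients from \<open>N\<close>.\<close>
  define N where "N = Suc M"
  have N: "N + k \<ge> 1" "N + k \<ge> M" "N + k - 1 = M + k" for k by (auto simp: N_def)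
  define a where "a k = (norm (x (M + k) - p))\<^sup>2" for k
  define D where "D k = (norm (x (Suc (M + k)) - x (M + k)))\<^sup>2" for k
  define R where "R k = \<alpha> (N + k) * (c * (d (N + k) * norm (\<eta> (N + k)))\<^sup>2)" for k
  define \<kappa> where "\<kappa> k = (1 - \<alpha> (N + k)) * \<xi> (N + k) + \<alpha> (N + k) * \<nu> (N + k)" for k
  define s where "s k = (1 - \<alpha> (N + k)) * \<xi> (N + k) * (1 + \<xi> (N + k))
    + \<alpha> (N + k) * \<nu> (N + k) * (1 + \<nu> (N + k)) + \<theta> * \<xi> (N + k) * (1 - \<xi> (N + k))" for k
  define t where "t k = \<theta> * (1 - \<xi> (N + k))" for k
  define K where "K = \<xi>\<^sub>u + 1 / (1 + \<theta>) * (1 - \<xi>\<^sub>u)"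
  have rec: "a (Suc (Suc k)) \<le> (1 + \<kappa> k) * a (Suc k) - \<kappa> k * a k + s k * D k - t k * D (Suc k) - R k"
    for k
  proof -
    let ?n = "N + k"
    have "(norm (x (?n + 1) - p))\<^sup>2 \<le> (1 + \<kappa> k) * (norm (x ?n - p))\<^sup>2 - \<kappa> k * (norm (x (?n - 1) - p))\<^sup>2
      + s k * (norm (x ?n - x (?n - 1)))\<^sup>2 - \<theta> * (1 - \<xi> ?n) * (norm (x (?n + 1) - x ?n))\<^sup>2
      - \<alpha> ?n * (c * (d ?n * norm (\<eta> ?n))\<^sup>2)"
    proof (rule inertial_averaging_step)
      show "(norm (u ?n - p))\<^sup>2
          \<le> (norm (x ?n + \<nu> ?n *\<^sub>R (x ?n - x (?n - 1)) - p))\<^sup>2 - c * (d ?n * norm (\<eta> ?n))\<^sup>2"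
        using gain[OF N(1,2)] w[OF N(1)] by simp
    qed (use \<alpha>b[OF N(1), of k] \<xi>b[OF N(1), of k] \<xi>\<^sub>u \<theta> v[OF N(1), of k] x[OF N(1), of k] in \<open>auto simp: \<kappa>_def s_def\<close>)
    then show ?thesis
      by (simp add: a_def D_def R_def t_def N_def)
  qed
  have nonneg: "0 \<le> a k" "0 \<le> D k" "0 \<le> R k" "0 \<le> s k" "0 \<le> \<kappa> k" for k
  proof -
    note b = \<alpha>b[OF N(1), of k] \<xi>b[OF N(1), of k] \<nu>b[OF N(1), of k]
    show "0 \<le> a k" "0 \<le> D k" "0 \<le> R k"
      using b \<open>c > 0\<close> by (auto simp: a_def D_def R_def)
    show "0 \<le> s k" "0 \<le> \<kappa> k"
      unfolding s_def \<kappa>_def using b \<xi>\<^sub>u \<theta> by (intro add_nonneg_nonneg mult_nonneg_nonneg; simp)+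
  qed
  have \<kappa>_mono: "\<kappa> k \<le> \<kappa> (Suc k)" for k
  proof -
    let ?n = "N + k"
    note b = \<alpha>b[OF N(1), of k] \<xi>b[OF N(1), of k] \<nu>b[OF N(1), of k]
    \<comment> \<open>Raising \<open>\<alpha>\<close> moves the average of \<open>\<xi>\<close> and \<open>\<nu>\<close> towards \<open>\<nu>\<close>, which is the larger one because
        \<open>\<xi> n \<le> \<xi>\<^sub>u < \<nu> 1 \<le> \<nu> n\<close>.\<close>
    have "\<kappa> k = \<xi> ?n + \<alpha> ?n * (\<nu> ?n - \<xi> ?n)"
      by (simp add: \<kappa>_def algebra_simps)
    also have "\<dots> \<le> \<xi> ?n + \<alpha> (Suc ?n) * (\<nu> ?n - \<xi> ?n)"
      using b \<xi>\<^sub>u by (intro add_left_mono mult_right_mono) auto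
    also have "\<dots> = (1 - \<alpha> (Suc ?n)) * \<xi> ?n + \<alpha> (Suc ?n) * \<nu> ?n"
      by (simp add: algebra_simps)
    also have "\<dots> \<le> (1 - \<alpha> (Suc ?n)) * \<xi> (Suc ?n) + \<alpha> (Suc ?n) * \<nu> (Suc ?n)"
      using b \<alpha>b[of "Suc ?n"] by (intro add_mono mult_left_mono) auto
    finally show ?thesis by (simp add: \<kappa>_def)
  qed
  have \<kappa>_le: "\<kappa> k \<le> K" for k
  proof -
    let ?n = "N + k"
    note b = \<alpha>b[OF N(1), of k] \<xi>b[OF N(1), of k] \<nu>b[OF N(1), of k]
    have "\<kappa> k \<le> (1 - \<alpha> ?n) * \<xi>\<^sub>u + \<alpha> ?n * 1"
      unfolding \<kappa>_def using b by (intro add_mono mult_left_mono) auto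
    also have "\<dots> = \<xi>\<^sub>u + \<alpha> ?n * (1 - \<xi>\<^sub>u)"
      by (simp add: algebra_simps)
    also have "\<dots> \<le> K"
      unfolding K_def using b \<xi>\<^sub>u by (intro add_left_mono mult_right_mono) auto
    finally show ?thesis .
  qed
  have "K < 1"
  proof -
    have "1 / (1 + \<theta>) * (1 - \<xi>\<^sub>u) < 1 * (1 - \<xi>\<^sub>u)"
      using \<theta> \<xi>\<^sub>u by (intro mult_strict_right_mono) auto
    then show ?thesis by (simp add: K_def)
  qed
  have st: "\<theta> * (1 - \<xi>\<^sub>u)\<^sup>2 - 2 + s (Suc k) \<le> t k" for k
    unfolding s_def t_def add_Suc_right
    using \<alpha>b[OF N(1), of "Suc k"] \<xi>b[OF N(1), of k] \<xi>b[OF N(1), of "Suc k"]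
      \<nu>b[OF N(1), of "Suc k"] \<xi>\<^sub>u \<theta>
    by (intro inertial_weights_margin) auto
  note lyapunov = inertial_lyapunov[where a = a and D = D and R = R and s = s and \<kappa> = \<kappa> and t = t,
      OF nonneg \<kappa>_mono \<kappa>_le \<open>K < 1\<close> rec margin st]

  have step0: "(\<lambda>k. x (Suc (M + k)) - x (M + k)) \<longlonglongrightarrow> 0"
    using lyapunov(2) unfolding D_def by (rule tendsto_zero_of_norm_sq)
  have wy0: "(\<lambda>k. w (N + k) - y (N + k)) \<longlonglongrightarrow> 0"
  proof (rule tendsto_zero_of_norm_sq, rule Lim_null_comparison[OF always_eventually])
    show "(\<lambda>k. R k / (\<alpha>\<^sub>l * c * \<rho>\<^sup>2)) \<longlonglongrightarrow> 0"
      using lyapunov(3) by (rule tendsto_divide_zero)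
    show "\<forall>k. norm ((norm (w (N + k) - y (N + k)))\<^sup>2) \<le> R k / (\<alpha>\<^sub>l * c * \<rho>\<^sup>2)"
    proof
      fix k
      let ?n = "N + k"
      have "(\<rho> * norm (w ?n - y ?n))\<^sup>2 \<le> (d ?n * norm (\<eta> ?n))\<^sup>2"
        using d_low[OF N(1,2)] \<open>\<rho> > 0\<close> by (intro power_mono) auto
      then have "c * (\<rho> * norm (w ?n - y ?n))\<^sup>2 \<le> c * (d ?n * norm (\<eta> ?n))\<^sup>2"
        using \<open>c > 0\<close> by simp
      then have "\<alpha>\<^sub>l * (c * (\<rho> * norm (w ?n - y ?n))\<^sup>2) \<le> R k"
        unfolding R_def using \<alpha>b[OF N(1), of k] \<open>c > 0\<close> A6(1)
        by (intro mult_mono) auto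
      then show "norm ((norm (w ?n - y ?n))\<^sup>2) \<le> R k / (\<alpha>\<^sub>l * c * \<rho>\<^sup>2)"
        using A6(1) \<open>c > 0\<close> \<open>\<rho> > 0\<close> by (simp add: pos_le_divide_eq power_mult_distrib mult_ac)
    qed
  qed
  have "(\<lambda>k. w (N + k) - x (N + k)) \<longlonglongrightarrow> 0"
  proof (rule Lim_null_comparison[OF always_eventually tendsto_norm_zero[OF step0]], rule)
    fix k
    show "norm (w (N + k) - x (N + k)) \<le> norm (x (Suc (M + k)) - x (M + k))"
      using w[OF N(1), of k] \<nu>b[OF N(1), of k]
      by (simp add: N_def mult_left_le_one_le)
  qed
  from tendsto_diff[OF wy0 this]
  have xy0: "(\<lambda>k. x (N + k) - y (N + k)) \<longlonglongrightarrow> 0" by simp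

  obtain B where B: "\<And>k. a k \<le> B" using lyapunov(1) by blast
  have x_bdd: "norm (x (N + k)) \<le> sqrt B + norm p" for k
  proof -
    have "norm (x (N + k) - p) \<le> sqrt B"
      using B[of "Suc k"] by (intro real_le_rsqrt) (simp add: a_def N_def)
    then show ?thesis
      using norm_triangle_ineq2[of "x (N + k)" p] by linarith
  qed
  obtain B' where "\<And>k. norm (x (N + k) - y (N + k)) \<le> B'"
    using convergent_imp_Bseq[OF convergentI[OF xy0]] unfolding Bseq_def by blast
  then have y_bdd: "norm (y (N + k)) \<le> B' + (sqrt B + norm p)" for k
    using x_bdd[of k] norm_triangle_ineq2[of "y (N + k)" "x (N + k)"]
    by (smt (verit) norm_minus_commute)

  have "\<exists>p\<in>VI C F. weakly_converges (\<lambda>k. x (N + k)) p"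
  proof (rule weakly_convergent_if_finite_cluster_points[OF x_bdd _ finite_VI])
    show "(\<lambda>k. x (N + Suc k) - x (N + k)) \<longlonglongrightarrow> 0"
      using LIMSEQ_Suc[OF step0] by (simp add: N_def)
  next
    fix r p' assume r: "strict_mono (r::nat\<Rightarrow>nat)" and z: "weakly_converges ((\<lambda>k. x (N + k)) \<circ> r) p'"
    then have weak: "weakly_converges (\<lambda>k. y (N + r k)) p'"
      using weakly_converges_perturb[OF z] LIMSEQ_subseq_LIMSEQ[OF xy0 r] by (simp add: o_def)
    show "p' \<in> VI C F"
    proof (rule weak_limit_mem_VI[where t = "\<lambda>k. \<beta> * lam (N + r k)", OF C(2,3) A1(2,3)])
      show "weakly_converges (\<lambda>k. y (N + r k)) p'" by (fact weak)
      show "(\<lambda>k. w (N + r k) - y (N + r k)) \<longlonglongrightarrow> 0"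
        using LIMSEQ_subseq_LIMSEQ[OF wy0 r] by (simp add: o_def)
      show "0 < \<beta> * m"
        using \<open>0 < \<beta>\<close> m by simp
      show "\<beta> * m \<le> \<beta> * lam (N + r k)" for k
        using low[OF N(1)] \<open>0 < \<beta>\<close> by simp
      show "y (N + r k) \<in> C" for k
        using yC[OF N(1)] .
      show "norm (y (N + r k)) \<le> B' + (sqrt B + norm p)" for k
        using y_bdd .
    qed (fact A3 var[OF N(1)])+
  qed
  then obtain p' where "p' \<in> VI C F" "weakly_converges (\<lambda>k. x (k + N)) p'"
    by (auto simp: add.commute)
  moreover from this(2) have "weakly_converges x p'"
    unfolding weakly_converges_def by (blast intro: LIMSEQ_offset)
  ultimately show ?thesis by blast
qed

end
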